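(* Let $K$ be a field and let $n$ be a positive integer. Let $N(n,K)$ be the set of nilpotent $n\times n$ matrices over $K$. Then the maximal dimension of an affine subspace of $M(n\times n,K)$ contained in $N(n,K)$ is $\frac{n(n-1)}{2}$. Moreover, if the characteristic of $K$ is zero, then every affine subspace of $M(n\times n,K)$ that is contained in $N(n,K)$ and is not a linear subspace has dimension less than or equal to $\frac{n(n-1)}{2}-1$.
   Context: $M(n\times n,K)$ denotes the $K$-vector space of $n\times n$ matrices over $K$. An affine subspace of $M(n\times n,K)$ is a set $S=P+Z$ with $P\in M(n\times n,K)$ and $Z$ a $K$-linear subspace of $M(n\times n,K)$; its dimension is $\dim_K Z$. It is "affine not linear" if it is not a linear subspace, i.e. $P\notin Z$ (equivalently $0\notin S$). "The maximal dimension is $d$" means that every such subspace has dimension at most $d$ and some such subspace has dimension exactly $d$. *)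

theory Defs
  imports "HOL-Analysis.Analysis"
begin

text \<open>
  The library scalar multiplication \<open>*s\<close> on \<open>'a^'n\<close> has scalars in the component type, so on
  \<open>'a^'n^'n\<close> it would multiply by row vectors; matrices over a field \<open>'a\<close> therefore need
  their own entrywise scaling to become an \<open>'a\<close>-vector space.
\<close>

definition mat_scale :: "'a::field \<Rightarrow> 'a^'n^'n \<Rightarrow> 'a^'n^'n"
  where "mat_scale c A = (\<chi> i j. c * A $ i $ j)"

global_interpretation matsp: vector_space "mat_scale :: 'a::field \<Rightarrow> 'a^'n^'n \<Rightarrow> 'a^'n^'n"
  by unfold_locales (simp_all add: mat_scale_def vec_eq_iff algebra_simps)

text \<open>
  The operation \<open>^\<close> on \<open>'a^'n^'n\<close> is the entrywise power, so the matrix power is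
  written as an iterated matrix product.
\<close>

definition nilpotent_mat :: "'a::field^'n^'n \<Rightarrow> bool"
  where "nilpotent_mat A \<longleftrightarrow> (\<exists>k. (((**) A) ^^ k) (mat 1) = 0)"

definition nilpotent_mats :: "('a::field^'n^'n) set"
  where "nilpotent_mats = {A. nilpotent_mat A}"

definition affine_subspace_of_dim :: "('a::field^'n^'n) set \<Rightarrow> nat \<Rightarrow> bool"
  where "affine_subspace_of_dim S d \<longleftrightarrow>
    (\<exists>P Z. matsp.subspace Z \<and> S = (+) P ` Z \<and> matsp.dim Z = d)"

end

theory Submission
  imports Defs
begin

text \<open>
  Let \<open>V\<close> be a linear space of matrices without eigenvalue \<open>1\<close>. Some basis index \<open>i\<close> is such that
  no nonzero member of \<open>V\<close> lives in row \<open>i\<close> only: otherwise choose such a member for every row,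
  follow nonzero entries to a chordless cycle, and scale the rows on the cycle so that their sum
  fixes the indicator vector of the cycle. The column \<open>i\<close> of a member of \<open>V\<close> is determined by its
  off-diagonal entries, and the members with zero column \<open>i\<close> embed into the matrices of size
  \<open>n - 1\<close> by deleting row and column \<open>i\<close>. By induction, members of \<open>V\<close> are determined by
  \<open>n(n-1)/2\<close> entries.

  If \<open>P + Z\<close> is nilpotent, then \<open>1 - P - Z\<close> consists of invertible matrices, so
  \<open>(1 - P)\<inverse> Z\<close> has no eigenvalue \<open>1\<close>. Over an infinite field the whole linear span of \<open>P\<close> and \<open>Z\<close> has
  no eigenvalue \<open>1\<close>, which gains one dimension when \<open>P \<notin> Z\<close>.
\<close>

section \<open>Linear spaces of matrices without eigenvalue 1\<close>

text \<open>Take a nonempty set of least cardinality in which every element has a successor. The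
  image of any choice of successors is again such a set, so by minimality every choice is injective,
  hence a permutation. If \<open>i\<close> had a second successor \<open>j\<close>, then
  \<open>j\<close> would also be the chosen successor of some \<open>k\<close> other than
  \<open>i\<close>, and redirecting \<open>i\<close> to \<open>j\<close> would break
  injectivity.\<close>

lemma exists_chordless_cycle:
  assumes "finite I" "I \<noteq> {}" and out: "\<And>i. i \<in> I \<Longrightarrow> \<exists>j\<in>I. E i j"
  obtains C where "C \<subseteq> I" "C \<noteq> {}" "\<And>i. i \<in> C \<Longrightarrow> \<exists>!j. j \<in> C \<and> E i j"
proof -
  define closed where "closed C \<longleftrightarrow> C \<subseteq> I \<and> C \<noteq> {} \<and> (\<forall>i\<in>C. \<exists>j\<in>C. E i j)" for C
  have "closed I" using assms by (auto simp: closed_def)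
  then obtain C where C: "closed C" and min: "\<And>D. closed D \<Longrightarrow> card C \<le> card D"
    using ex_has_least_nat[of closed I card] by blast
  have finC: "finite C" using C \<open>finite I\<close> by (auto simp: closed_def intro: finite_subset)
  have inj: "inj_on f C" if f: "\<And>i. i \<in> C \<Longrightarrow> f i \<in> C \<and> E i (f i)" for f
  proof -
    have "closed (f ` C)" using C f unfolding closed_def by blast
    then have "card C \<le> card (f ` C)" by (rule min)
    then show ?thesis using finC by (simp add: card_image_le eq_card_imp_inj_on le_antisym)
  qed
  obtain f where f: "\<And>i. i \<in> C \<Longrightarrow> f i \<in> C \<and> E i (f i)"
    using C unfolding closed_def by metis
  have "j = f i" if i: "i \<in> C" and j: "j \<in> C" "E i j" for i j
  proof (rule ccontr)
    assume ne: "j \<noteq> f i"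
    have "f ` C = C"
      using inj[OF f] f finC by (simp add: endo_inj_surj image_subsetI)
    then obtain k where k: "k \<in> C" "f k = j" using j by (metis imageE)
    have "inj_on (f(i := j)) C" using f j by (intro inj) auto
    with i k ne show False by (auto simp: inj_on_def fun_upd_def split: if_splits)
  qed
  with f have "\<exists>!j. j \<in> C \<and> E i j" if "i \<in> C" for i
    using that by (intro ex1I[of _ "f i"]) auto
  with C show ?thesis
    by (intro that[of C]) (auto simp: closed_def)
qed

text \<open>Smaller matrices are modelled as matrices of the fixed type supported on
  \<open>I\<close> times \<open>I\<close>; this lets the later induction run on
  \<open>card I\<close>.\<close>

lemma exists_row_free_index:
  fixes V :: "('a::field^'n^'n) set"
  assumes V: "matsp.subspace V" and "I \<noteq> {}"
    and supp: "\<And>A k j. A \<in> V \<Longrightarrow> k \<notin> I \<or> j \<notin> I \<Longrightarrow> A $ k $ j = 0"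
    and eig: "\<And>A x. A \<in> V \<Longrightarrow> A *v x = x \<Longrightarrow> x = 0"
  shows "\<exists>i\<in>I. \<forall>A\<in>V. (\<forall>k j. k \<noteq> i \<longrightarrow> A $ k $ j = 0) \<longrightarrow> A = 0"
proof (rule ccontr)
  assume "\<not> ?thesis"
  then have "\<forall>i\<in>I. \<exists>A\<in>V. (\<forall>k j. k \<noteq> i \<longrightarrow> A $ k $ j = 0) \<and> A \<noteq> 0"
    by blast
  then obtain R where R: "\<And>i. i \<in> I \<Longrightarrow> R i \<in> V"
    and row: "\<And>i k j. i \<in> I \<Longrightarrow> k \<noteq> i \<Longrightarrow> R i $ k $ j = 0"
    and nz: "\<And>i. i \<in> I \<Longrightarrow> R i \<noteq> 0"
    by metis
  have "\<exists>j\<in>I. R i $ i $ j \<noteq> 0" if i: "i \<in> I" for i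
  proof -
    obtain k j where "R i $ k $ j \<noteq> 0" using nz[OF i] by (auto simp: vec_eq_iff)
    then show ?thesis using row[OF i, of k j] supp[OF R[OF i], of k j] by auto
  qed
  then obtain C where C: "C \<subseteq> I" "C \<noteq> {}"
    and uniq: "\<And>i. i \<in> C \<Longrightarrow> \<exists>!j. j \<in> C \<and> R i $ i $ j \<noteq> 0"
    using exists_chordless_cycle[of I "\<lambda>i j. R i $ i $ j \<noteq> 0"] \<open>I \<noteq> {}\<close> by auto
  \<comment> \<open>Exactly one term is nonzero because the cycle has no chords. Dividing row
    \<open>i\<close> by \<open>s i\<close> makes its entries over \<open>C\<close> sum to 1.\<close>
  define s where "s i = (\<Sum>j\<in>C. R i $ i $ j)" for i
  have s: "s i \<noteq> 0" if i: "i \<in> C" for i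
  proof -
    obtain f where f: "f \<in> C" "R i $ i $ f \<noteq> 0" "\<And>j. j \<in> C \<Longrightarrow> R i $ i $ j \<noteq> 0 \<Longrightarrow> j = f"
      using uniq[OF i] by blast
    have "s i = (\<Sum>j\<in>C. if j = f then R i $ i $ f else 0)"
      unfolding s_def by (intro sum.cong) (auto dest: f(3))
    then show ?thesis using f(1,2) by simp
  qed
  define M where "M = (\<Sum>i\<in>C. mat_scale (1 / s i) (R i))"
  have M: "M \<in> V"
    unfolding M_def
  proof (rule matsp.subspace_sum[OF V])
    fix i assume "i \<in> C"
    then have "R i \<in> V" using C by (intro R) auto
    then show "mat_scale (1 / s i) (R i) \<in> V" by (rule matsp.subspace_scale[OF V])
  qed
  have Mk: "M $ k $ j = (if k \<in> C then R k $ k $ j / s k else 0)" for k j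
  proof -
    have "M $ k $ j = (\<Sum>i\<in>C. R i $ k $ j / s i)"
      by (simp add: M_def mat_scale_def)
    also have "\<dots> = (\<Sum>i\<in>C. if i = k then R k $ k $ j / s k else 0)"
      using row C by (intro sum.cong) auto
    finally show ?thesis by simp
  qed
  define x :: "'a^'n" where "x = (\<chi> j. if j \<in> C then 1 else 0)"
  have "M *v x = x"
  proof (simp add: vec_eq_iff, intro allI)
    fix k
    have "(M *v x) $ k = (\<Sum>j\<in>UNIV. if j \<in> C then M $ k $ j else 0)"
      unfolding matrix_vector_mult_def x_def by (auto intro!: sum.cong)
    also have "\<dots> = (\<Sum>j\<in>C. M $ k $ j)"
      by (simp flip: sum.inter_restrict)
    also have "\<dots> = x $ k"
      using s by (auto simp: Mk x_def s_def simp flip: sum_divide_distrib)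
    finally show "(M *v x) $ k = x $ k" .
  qed
  then have "x = 0" by (rule eig[OF M])
  moreover obtain k where "k \<in> C" using C by blast
  then have "x $ k = 1" by (simp add: x_def)
  ultimately show False by simp
qed

text \<open>Restriction to the positions in \<open>T\<close> is injective on \<open>V\<close>, so
  \<open>card T\<close> bounds the dimension. Removing one index from a set of \<open>m + 1\<close>
  costs the \<open>m\<close> off-diagonal positions of its column, and these costs add up to the
  triangular number.\<close>

lemma exists_separating_entries:
  fixes V :: "('a::field^'n^'n) set"
  assumes "matsp.subspace V"
    and "\<And>A k j. A \<in> V \<Longrightarrow> k \<notin> I \<or> j \<notin> I \<Longrightarrow> A $ k $ j = 0"
    and "\<And>A x. A \<in> V \<Longrightarrow> A *v x = x \<Longrightarrow> x = 0"
  shows "\<exists>T. card T \<le> card I * (card I - 1) div 2 \<and>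
           (\<forall>A\<in>V. (\<forall>(k, j)\<in>T. A $ k $ j = 0) \<longrightarrow> A = 0)"
  using assms
proof (induction "card I" arbitrary: I V)
  case 0
  then have "I = {}" by simp
  with "0.prems"(2) show ?case by (intro exI[of _ "{}"]) (auto simp: vec_eq_iff)
next
  case (Suc m)
  note V = Suc.prems(1) and supp = Suc.prems(2) and eig = Suc.prems(3)
  have "I \<noteq> {}" using Suc.hyps(2) by auto
  then obtain i where i: "i \<in> I"
    and free: "\<And>A. A \<in> V \<Longrightarrow> (\<And>k j. k \<noteq> i \<Longrightarrow> A $ k $ j = 0) \<Longrightarrow> A = 0"
    using exists_row_free_index[of V I] V supp eig by blast
  \<comment> \<open>On \<open>U\<close>, where column \<open>i\<close> already vanishes, clearing
    row \<open>i\<close> deletes both row and column. The choice of \<open>i\<close> makes this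
    injective, since a member killed by \<open>del\<close> lives in row \<open>i\<close>
    only.\<close>
  define del :: "'a^'n^'n \<Rightarrow> 'a^'n^'n" where "del A = (\<chi> k j. if k = i then 0 else A $ k $ j)" for A
  define U where "U = {A \<in> V. \<forall>k. A $ k $ i = 0}"
  have sub: "matsp.subspace (del ` U)"
  proof (rule matsp.subspaceI)
    show "0 \<in> del ` U"
      using matsp.subspace_0[OF V] by (intro image_eqI[of _ _ 0]) (auto simp: U_def del_def vec_eq_iff)
  next
    fix x y assume "x \<in> del ` U" "y \<in> del ` U"
    then obtain a b where "a \<in> U" "b \<in> U" "x = del a" "y = del b" by auto
    then show "x + y \<in> del ` U"
      using matsp.subspace_add[OF V]
      by (intro image_eqI[of _ _ "a + b"]) (auto simp: U_def del_def vec_eq_iff)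
  next
    fix c x assume "x \<in> del ` U"
    then obtain a where "a \<in> U" "x = del a" by auto
    then show "mat_scale c x \<in> del ` U"
      using matsp.subspace_scale[OF V]
      by (intro image_eqI[of _ _ "mat_scale c a"]) (auto simp: U_def del_def vec_eq_iff mat_scale_def)
  qed
  have eig': "x = 0" if A: "A \<in> del ` U" "A *v x = x" for A x
  proof -
    obtain B where B: "B \<in> V" "\<And>k. B $ k $ i = 0" "A = del B" using A by (auto simp: U_def)
    \<comment> \<open>Column \<open>i\<close> of \<open>B\<close> is zero, so \<open>B *v x\<close>
      ignores coordinate \<open>i\<close> of \<open>x\<close>. Resetting that coordinate to the
      value \<open>B\<close> prescribes turns a fixed vector of \<open>del B\<close> into one of
      \<open>B\<close>.\<close>
    define y :: "'a^'n" where "y = (\<chi> k. if k = i then (B *v x) $ i else x $ k)"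
    have Bxy: "B *v y = B *v x"
      by (auto simp: vec_eq_iff matrix_vector_mult_def y_def B(2) intro!: sum.cong)
    have "(B *v y) $ k = y $ k" for k
    proof (cases "k = i")
      case True
      then show ?thesis by (simp add: Bxy) (simp add: y_def)
    next
      case False
      then have "(B *v x) $ k = (A *v x) $ k"
        by (simp add: B(3) del_def matrix_vector_mult_def)
      then show ?thesis using False A(2) by (simp add: Bxy) (simp add: y_def)
    qed
    then have "y = 0" using eig[OF B(1), of y] by (simp add: vec_eq_iff)
    moreover have "x $ i = 0"
      using arg_cong[OF A(2), of "\<lambda>v. v $ i"] by (simp add: B(3) del_def matrix_vector_mult_def)
    ultimately show "x = 0" by (auto simp: y_def vec_eq_iff split: if_splits)
  qed
  have m: "m = card (I - {i})" using Suc.hyps(2) i by simp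
  have supp': "A $ k $ j = 0" if "A \<in> del ` U" "k \<notin> I - {i} \<or> j \<notin> I - {i}" for A k j
    using that supp by (auto simp: U_def del_def)
  have "\<exists>T. card T \<le> m * (m - 1) div 2 \<and>
      (\<forall>A\<in>del ` U. (\<forall>(k, j)\<in>T. A $ k $ j = 0) \<longrightarrow> A = 0)"
    unfolding m by (rule Suc.hyps(1)[OF m sub]) (erule (1) supp' eig')+
  then obtain T where T: "card T \<le> m * (m - 1) div 2"
    and inj: "\<And>A. A \<in> U \<Longrightarrow> (\<forall>(k, j)\<in>T. del A $ k $ j = 0) \<Longrightarrow> del A = 0"
    by blast
  \<comment> \<open>Positions of \<open>T\<close> in row \<open>i\<close> are dropped, as
    \<open>del\<close> clears them anyway; the off-diagonal positions of column \<open>i\<close> are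
    added.\<close>
  define T' where "T' = (T - {i} \<times> UNIV) \<union> (I - {i}) \<times> {i}"
  have "card T' \<le> card (T - {i} \<times> UNIV) + card ((I - {i}) \<times> {i})"
    unfolding T'_def by (rule card_Un_le)
  also have "\<dots> \<le> card T + m"
    using i m by (intro add_mono card_mono) (auto simp: card_cartesian_product)
  also have "\<dots> \<le> card I * (card I - 1) div 2"
    using T by (cases m) (auto simp: field_simps simp flip: Suc.hyps(2))
  finally have "card T' \<le> card I * (card I - 1) div 2" .
  moreover have "A = 0" if A: "A \<in> V" "\<forall>(k, j)\<in>T'. A $ k $ j = 0" for A
  proof -
    have col: "A $ k $ i = 0" if "k \<noteq> i" for k
      using A supp[OF A(1), of k i] that by (auto simp: T'_def)
    \<comment> \<open>With zeros off the diagonal in column \<open>i\<close>,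
      \<open>axis i 1\<close> is an eigenvector for \<open>A $ i $ i\<close>. If this were nonzero,
      a multiple of \<open>A\<close> in \<open>V\<close> would have eigenvalue 1.\<close>
    have "A $ i $ i = 0"
    proof (rule ccontr)
      assume nz: "A $ i $ i \<noteq> 0"
      have "mat_scale (1 / A $ i $ i) A *v axis i 1 = axis i 1"
        using nz col by (auto simp: vec_eq_iff mat_scale_def matrix_vector_mul_component
            matrix_vector_mult_def axis_def if_distrib cong: if_cong)
      then have "axis i (1::'a) = 0"
        using eig matsp.subspace_scale[OF V A(1)] by blast
      then show False by (simp add: axis_eq_0_iff)
    qed
    with col have "A $ k $ i = 0" for k by (cases "k = i") auto
    with A(1) have "A \<in> U" by (simp add: U_def)
    moreover have "\<forall>(k, j)\<in>T. del A $ k $ j = 0"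
      using A(2) by (auto simp: T'_def del_def)
    ultimately have "del A = 0" by (rule inj)
    then show ?thesis
      by (intro free[OF A(1)]) (auto simp: del_def vec_eq_iff split: if_splits)
  qed
  ultimately show ?case by blast
qed

section \<open>Matrix units and the dimension bound\<close>

definition mat_unit :: "'n \<times> 'n \<Rightarrow> 'a::field^'n^'n"
  where "mat_unit p = (\<chi> k j. if (k, j) = p then 1 else 0)"

lemma mem_span_mat_unit:
  fixes A :: "'a::field^'n^'n"
  assumes "\<And>k j. (k, j) \<notin> T \<Longrightarrow> A $ k $ j = 0"
  shows "A \<in> matsp.span (mat_unit ` T)"
proof -
  have "(\<Sum>p\<in>T. mat_scale (A $ fst p $ snd p) (mat_unit p) $ k $ j) = A $ k $ j" for k j
  proof -
    have "(\<Sum>p\<in>T. mat_scale (A $ fst p $ snd p) (mat_unit p) $ k $ j) =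
          (\<Sum>p\<in>T. if p = (k, j) then A $ k $ j else 0)"
      by (intro sum.cong) (auto simp: mat_scale_def mat_unit_def)
    then show ?thesis using assms[of k j] by auto
  qed
  then have "A = (\<Sum>p\<in>T. mat_scale (A $ fst p $ snd p) (mat_unit p))"
    by (simp add: vec_eq_iff)
  also have "\<dots> \<in> matsp.span (mat_unit ` T)"
    by (intro matsp.span_sum matsp.span_scale matsp.span_base) auto
  finally show ?thesis .
qed

lemma independent_mat_unit: "matsp.independent (mat_unit ` T :: ('a::field^'n^'n) set)"
  and inj_mat_unit: "inj (mat_unit :: 'n \<times> 'n \<Rightarrow> 'a::field^'n^'n)"
proof -
  show inj: "inj (mat_unit :: 'n \<times> 'n \<Rightarrow> 'a::field^'n^'n)"
  proof (rule injI)
    fix p q :: "'n \<times> 'n"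
    assume "(mat_unit p :: 'a^'n^'n) = mat_unit q"
    then have "(mat_unit p :: 'a^'n^'n) $ fst p $ snd p = mat_unit q $ fst p $ snd p" by simp
    then show "p = q" by (simp add: mat_unit_def split: if_splits)
  qed
  show "matsp.independent (mat_unit ` T :: ('a^'n^'n) set)"
  proof (rule matsp.independent_if_scalars_zero)
    fix f :: "'a^'n^'n \<Rightarrow> 'a" and x :: "'a^'n^'n"
    assume sum: "(\<Sum>y\<in>mat_unit ` T. mat_scale (f y) y) = 0" and "x \<in> mat_unit ` T"
    then obtain k j where kj: "x = mat_unit (k, j)" "(k, j) \<in> T" by auto
    have "0 = (\<Sum>y\<in>mat_unit ` T. mat_scale (f y) y) $ k $ j" using sum by simp
    also have "\<dots> = (\<Sum>p\<in>T. mat_scale (f (mat_unit p)) (mat_unit p) $ k $ j)"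
      by (subst sum.reindex) (auto intro: inj_on_subset[OF inj])
    also have "\<dots> = (\<Sum>p\<in>T. if p = (k, j) then f x else 0)"
      using kj by (intro sum.cong) (auto simp: mat_scale_def mat_unit_def)
    also have "\<dots> = f x" using kj by simp
    finally show "f x = 0" by simp
  qed simp
qed

text \<open>Keeping only the entries of \<open>Q ** A\<close> at positions in \<open>T\<close> is a
  linear map into the span of the matrix units of \<open>T\<close>, and \<open>sep\<close> makes it
  injective on the span of \<open>B\<close>.\<close>

lemma card_le_separating_entries:
  fixes B :: "('a::field^'n^'n) set" and Q :: "'a^'n^'n"
  assumes "matsp.independent B"
    and sep: "\<And>A. A \<in> matsp.span B \<Longrightarrow> (\<forall>(k, j)\<in>T. (Q ** A) $ k $ j = 0) \<Longrightarrow> A = 0"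
  shows "card B \<le> card T"
proof -
  define f :: "'a^'n^'n \<Rightarrow> 'a^'n^'n"
    where "f A = (\<chi> k j. if (k, j) \<in> T then (Q ** A) $ k $ j else 0)" for A
  have lin: "Vector_Spaces.linear mat_scale mat_scale f"
    by unfold_locales
      (auto simp: f_def mat_scale_def vec_eq_iff matrix_matrix_mult_def algebra_simps
        sum.distrib sum_distrib_left)
  interpret f: Vector_Spaces.linear mat_scale mat_scale f by (rule lin)
  have inj: "inj_on f (matsp.span B)"
  proof (subst f.inj_on_iff_eq_0[OF matsp.subspace_span], intro ballI impI)
    fix A assume "A \<in> matsp.span B" "f A = 0"
    then show "A = 0" by (intro sep) (auto simp: f_def vec_eq_iff split: if_splits)
  qed
  then have ind: "matsp.independent (f ` B)"
    using assms(1) by (intro f.independent_injective_image)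
  have "f ` B \<subseteq> matsp.span (mat_unit ` T)"
    by (auto simp: f_def intro: mem_span_mat_unit)
  with ind have "card (f ` B) \<le> card (mat_unit ` T :: ('a^'n^'n) set)"
    using matsp.independent_span_bound[of "mat_unit ` T :: ('a^'n^'n) set"] by simp
  also have "\<dots> \<le> card T" by (simp add: card_image_le)
  also have "card (f ` B) = card B"
    using inj matsp.span_superset by (metis card_image inj_on_subset)
  finally show ?thesis .
qed

lemma mat_scale_mult: "mat_scale c A ** Q = mat_scale c (A ** Q)"
  by (simp add: vec_eq_iff mat_scale_def matrix_matrix_mult_def sum_distrib_left mult.assoc)

lemma mult_mat_scale: "Q ** mat_scale c A = mat_scale c (Q ** A)"
  by (simp add: vec_eq_iff mat_scale_def matrix_matrix_mult_def sum_distrib_left algebra_simps)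

text \<open>Left multiplication by \<open>Q\<close> carries the span of \<open>B\<close> injectively
  to a space without eigenvalue 1. The uses are \<open>Q\<close> inverse to \<open>mat 1 - P\<close>
  for the general bound, and \<open>Q = mat 1\<close> for the strict one.\<close>

lemma card_le_if_no_eigenvalue_1:
  fixes B :: "('a::field^'n^'n) set"
  assumes B: "matsp.independent B" and Q: "\<And>A :: 'a^'n^'n. Q ** A = 0 \<Longrightarrow> A = 0"
    and eig: "\<And>A x. A \<in> matsp.span B \<Longrightarrow> (Q ** A) *v x = x \<Longrightarrow> x = 0"
  shows "card B \<le> CARD('n) * (CARD('n) - 1) div 2"
proof -
  have "matsp.subspace ((**) Q ` matsp.span B)"
  proof (rule matsp.subspaceI)
    show "0 \<in> (**) Q ` matsp.span B"
      using matsp.span_zero by (intro image_eqI[of _ _ 0]) auto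
  next
    fix x y assume "x \<in> (**) Q ` matsp.span B" "y \<in> (**) Q ` matsp.span B"
    then show "x + y \<in> (**) Q ` matsp.span B"
      by (auto simp: matsp.span_add simp flip: matrix_add_ldistrib)
  next
    fix c x assume "x \<in> (**) Q ` matsp.span B"
    then show "mat_scale c x \<in> (**) Q ` matsp.span B"
      by (auto simp: matsp.span_scale simp flip: mult_mat_scale)
  qed
  then have "\<exists>T. card T \<le> CARD('n) * (CARD('n) - 1) div 2 \<and>
      (\<forall>A\<in>(**) Q ` matsp.span B. (\<forall>(k, j)\<in>T. A $ k $ j = 0) \<longrightarrow> A = 0)"
    by (rule exists_separating_entries) (auto intro: eig)
  then obtain T where T: "card T \<le> CARD('n) * (CARD('n) - 1) div 2"
    and sep: "\<And>A. A \<in> (**) Q ` matsp.span B \<Longrightarrow> (\<forall>(k, j)\<in>T. A $ k $ j = 0) \<Longrightarrow> A = 0"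
    by blast
  have "card B \<le> card T"
  proof (rule card_le_separating_entries[OF B])
    fix A assume "A \<in> matsp.span B" "\<forall>(k, j)\<in>T. (Q ** A) $ k $ j = 0"
    then have "Q ** A = 0" by (intro sep) auto
    then show "A = 0" by (rule Q)
  qed
  with T show ?thesis by simp
qed

section \<open>The upper bound for affine nilpotent spaces\<close>

lemma nilpotent_mat_fixed_vec:
  assumes "nilpotent_mat A" "A *v x = x"
  shows "x = 0"
proof -
  have "(((**) A) ^^ k) (mat 1) *v x = x" for k
    by (induction k) (simp_all add: assms(2) flip: matrix_vector_mul_assoc)
  with assms(1) show ?thesis unfolding nilpotent_mat_def by (metis matrix_vector_mult_0)
qed

lemma affine_nilpotent_dim_le:
  fixes P :: "'a::field^'n^'n"
  assumes Z: "matsp.subspace Z" and nil: "(+) P ` Z \<subseteq> nilpotent_mats"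
  shows "matsp.dim Z \<le> CARD('n) * (CARD('n) - 1) div 2"
proof -
  obtain B where B: "B \<subseteq> Z" "matsp.independent B" "Z \<subseteq> matsp.span B" "card B = matsp.dim Z"
    by (rule matsp.basis_exists)
  have span: "matsp.span B = Z" using B Z by (simp add: matsp.span_subspace)
  have fixed: "x = 0" if "A \<in> Z" "(P + A) *v x = x" for A x
    using that nil by (intro nilpotent_mat_fixed_vec[of "P + A"]) (auto simp: nilpotent_mats_def)
  have "x = 0" if "(mat 1 - P) *v x = 0" for x
    using that fixed[of 0 x] matsp.subspace_0[OF Z] by (simp add: matrix_vector_mult_diff_rdistrib)
  then have "\<exists>Q. Q ** (mat 1 - P) = mat 1"
    by (simp add: matrix_left_invertible_ker)
  then obtain Q where "Q ** (mat 1 - P) = mat 1" ..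
  then have Q: "(mat 1 - P) ** Q = mat 1"
    by (rule matrix_left_right_inverse[THEN iffD1])
  have "card B \<le> CARD('n) * (CARD('n) - 1) div 2"
  proof (rule card_le_if_no_eigenvalue_1[where Q = Q])
    show "A = 0" if "Q ** A = 0" for A
      using that Q by (metis matrix_mul_assoc matrix_mul_lid times0_right)
    show "x = 0" if "A \<in> matsp.span B" "(Q ** A) *v x = x" for A x
    proof (rule fixed)
      show "A \<in> Z" using that span by simp
      \<comment> \<open>Since \<open>Q ** A\<close> fixes \<open>x\<close>, this reads
        \<open>A *v x = x - P *v x\<close>, so the nilpotent matrix \<open>P + A\<close> fixes
        \<open>x\<close>.\<close>
      have "A *v x = (mat 1 - P) *v ((Q ** A) *v x)"
        by (simp add: matrix_vector_mul_assoc matrix_mul_assoc Q)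
      then show "(P + A) *v x = x"
        using that(2) by (simp add: matrix_vector_mult_diff_rdistrib matrix_vector_mult_add_rdistrib)
    qed
  qed (rule B)
  with B show ?thesis by simp
qed

section \<open>Determinants over \<open>K[X]\<close> and the strict bound over infinite
  fields\<close>

lemma poly_det: "poly (det A) c = det (\<chi> i j. poly (A $ i $ j) c)"
  by (simp add: det_def poly_sum poly_prod)

text \<open>Let \<open>X\<close> be \<open>N\<close> times the indeterminate. The geometric series
  in \<open>X\<close> breaks off by nilpotency and inverts \<open>mat 1 - X\<close> over the
  polynomial ring, so the determinant of \<open>mat 1 - X\<close> is a unit there.\<close>

lemma det_one_minus_nilpotent:
  fixes N :: "'a::field^'n^'n"
  assumes "nilpotent_mat N"
  shows "det (mat 1 - N) = 1"
proof -
  obtain k where k: "(((**) N) ^^ k) (mat 1) = 0"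
    using assms unfolding nilpotent_mat_def by blast
  define X :: "'a poly^'n^'n" where "X = (\<chi> i j. [:0, N $ i $ j:])"
  define S where "S m = (\<Sum>l<m. (((**) X) ^^ l) (mat 1))" for m
  have Xl: "(((**) X) ^^ l) (mat 1) = (\<chi> i j. monom ((((**) N) ^^ l) (mat 1) $ i $ j) l)" for l
  proof (induction l)
    case 0
    show ?case by (auto simp: vec_eq_iff mat_def monom_0 one_pCons)
  next
    case (Suc l)
    have "[:0, a:] * monom b l = monom (a * b) (Suc l)" for a b :: 'a
      by (simp add: monom_Suc smult_monom)
    then show ?case
      by (simp add: Suc vec_eq_iff) (simp add: matrix_matrix_mult_def X_def monom_sum)
  qed
  have sub: "(mat 1 - X) ** Y = Y - X ** Y" for Y
    by (simp add: matrix_matrix_mult_def vec_eq_iff left_diff_distrib sum_subtractf)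
      (simp add: mat_def if_distrib[of "\<lambda>x. x * _"] cong: if_cong)
  have "(mat 1 - X) ** S m = mat 1 - (((**) X) ^^ m) (mat 1)" for m
    by (induction m) (simp_all add: S_def matrix_add_ldistrib sub)
  from this[of k] have "(mat 1 - X) ** S k = mat 1"
    using k by (simp add: Xl vec_eq_iff)
  then have "det (mat 1 - X) * det (S k) = 1"
    by (metis det_I det_mul)
  then have "det (mat 1 - X) dvd 1" by (metis dvd_triv_left)
  then obtain c where c: "det (mat 1 - X) = [:c:]"
    by (auto simp: is_unit_poly_iff)
  have "poly (det (mat 1 - X)) t = det (\<chi> i j. mat 1 $ i $ j - t * N $ i $ j)" for t
    unfolding poly_det by (rule arg_cong[of _ _ det]) (auto simp: vec_eq_iff X_def mat_def)
  \<comment> \<open>A unit of \<open>K[X]\<close> is constant, so it takes the same value at \<open>0\<close> and at \<open>1\<close>.\<close>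
  from this[of 0] this[of 1] show ?thesis
    unfolding c by (simp add: minus_vec_def)
qed

text \<open>For \<open>c \<noteq> 0\<close> the matrix \<open>c P + A\<close> is a multiple of an element of the nilpotent affine
  space, so the polynomial \<open>det (1 - (c P + A))\<close> in \<open>c\<close> is \<open>1\<close> at infinitely many points,
  hence also at \<open>c = 0\<close>.\<close>

lemma span_affine_nilpotent_fixed_vec:
  fixes P :: "'a::field^'n^'n"
  assumes Z: "matsp.subspace Z" and nil: "(+) P ` Z \<subseteq> nilpotent_mats"
    and inf: "infinite (UNIV :: 'a set)"
    and A: "A \<in> Z" "(mat_scale c P + A) *v x = x"
  shows "x = 0"
proof -
  have nil': "nilpotent_mat (mat_scale t P + A)" if "t \<noteq> 0" for t
  proof -
    have "mat_scale (1 / t) A \<in> Z" by (intro matsp.subspace_scale Z A)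
    then have "nilpotent_mat (P + mat_scale (1 / t) A)" using nil by (auto simp: nilpotent_mats_def)
    moreover have "(((**) (mat_scale t B)) ^^ k) (mat 1) = mat_scale (t ^ k) ((((**) B) ^^ k) (mat 1))"
      for B :: "'a^'n^'n" and k
      by (induction k) (simp_all add: mult_mat_scale mat_scale_mult)
    ultimately have "nilpotent_mat (mat_scale t (P + mat_scale (1 / t) A))"
      unfolding nilpotent_mat_def by (metis matsp.scale_zero_right)
    moreover have "mat_scale t (P + mat_scale (1 / t) A) = mat_scale t P + A"
      using \<open>t \<noteq> 0\<close> by (simp add: matsp.scale_right_distrib)
    ultimately show ?thesis by simp
  qed
  define p where "p = det (\<chi> i j. [:mat 1 $ i $ j - A $ i $ j, - P $ i $ j:])"
  have p: "poly p t = det (mat 1 - (mat_scale t P + A))" for t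
    unfolding p_def poly_det by (rule arg_cong[of _ _ det]) (simp add: vec_eq_iff mat_scale_def)
  have "poly (p - 1) t = 0" if "t \<noteq> 0" for t
    using det_one_minus_nilpotent[OF nil'[OF that]] by (simp add: p)
  then have "- {0} \<subseteq> {t. poly (p - 1) t = 0}" by auto
  moreover have "infinite (- {0} :: 'a set)" using inf by (simp add: finite_compl)
  ultimately have "p - 1 = 0"
    using poly_roots_finite finite_subset by metis
  then have "det (mat 1 - (mat_scale c P + A)) = 1" by (simp flip: p)
  then have "invertible (mat 1 - (mat_scale c P + A))"
    by (simp add: invertible_det_nz)
  moreover have "(mat 1 - (mat_scale c P + A)) *v x = 0"
    using A(2) by (simp add: matrix_vector_mult_diff_rdistrib)
  ultimately show ?thesis
    using matrix_left_invertible_ker invertible_def by metis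
qed

lemma affine_nilpotent_dim_less:
  fixes P :: "'a::field^'n^'n"
  assumes Z: "matsp.subspace Z" and nil: "(+) P ` Z \<subseteq> nilpotent_mats"
    and inf: "infinite (UNIV :: 'a set)" and P: "P \<notin> Z"
  shows "Suc (matsp.dim Z) \<le> CARD('n) * (CARD('n) - 1) div 2"
proof -
  obtain B where B: "B \<subseteq> Z" "matsp.independent B" "Z \<subseteq> matsp.span B" "card B = matsp.dim Z"
    by (rule matsp.basis_exists)
  have span: "matsp.span B = Z" using B Z by (simp add: matsp.span_subspace)
  \<comment> \<open>An infinite set has \<open>card\<close> 0, so finiteness is what makes
    \<open>insert P B\<close> count one more than \<open>B\<close>.\<close>
  have "finite B"
  proof (rule matsp.independent_span_bound[THEN conjunct1])
    show "B \<subseteq> matsp.span (range mat_unit)"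
      by (auto intro: mem_span_mat_unit)
  qed (simp_all add: B)
  have "card (insert P B) \<le> CARD('n) * (CARD('n) - 1) div 2"
  proof (rule card_le_if_no_eigenvalue_1[where Q = "mat 1"])
    show "matsp.independent (insert P B)" using B P span by (simp add: matsp.independent_insert)
    fix A :: "'a^'n^'n" and x
    assume A: "A \<in> matsp.span (insert P B)" "(mat 1 ** A) *v x = x"
    then obtain c where "A - mat_scale c P \<in> Z" using span by (auto simp: matsp.span_insert)
    with A show "x = 0"
      using span_affine_nilpotent_fixed_vec[OF Z nil inf, of "A - mat_scale c P" c x] by simp
  qed simp
  moreover have "P \<notin> B" using B P by blast
  ultimately show ?thesis using B \<open>finite B\<close> by simp
qed

section \<open>Strictly triangular matrices attain the bound\<close>

lemma exists_nilpotent_subspace: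
  "\<exists>Z :: ('a::field^'n^'n) set. matsp.subspace Z \<and> Z \<subseteq> nilpotent_mats \<and>
     matsp.dim Z = CARD('n) * (CARD('n) - 1) div 2"
proof -
  obtain h :: "'n \<Rightarrow> nat" where h: "bij_betw h UNIV {0..<CARD('n)}"
    using ex_bij_betw_finite_nat[of "UNIV :: 'n set"] by auto
  then have inj: "h i = h j \<longleftrightarrow> i = j" and bound: "h i < CARD('n)" for i j
    by (auto simp: bij_betw_def inj_on_def)
  define T where "T = {(i, j). h i < h j}"
  \<comment> \<open>The positions split into those above the diagonal, their mirror images and the
    diagonal itself, so twice \<open>card T\<close> plus \<open>n\<close> is
    \<open>n * n\<close>.\<close>
  have "card T + card (prod.swap ` T) + card (Id :: 'n rel) = card (UNIV :: ('n \<times> 'n) set)"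
  proof -
    have "UNIV = T \<union> prod.swap ` T \<union> Id"
      using inj by (auto simp: T_def image_iff) (metis linorder_neqE_nat)
    moreover have "card (T \<union> prod.swap ` T \<union> Id) = card (T \<union> prod.swap ` T) + card (Id :: 'n rel)"
      by (rule card_Un_disjoint) (auto simp: T_def)
    moreover have "card (T \<union> prod.swap ` T) = card T + card (prod.swap ` T)"
      by (rule card_Un_disjoint) (auto simp: T_def)
    ultimately show ?thesis by simp
  qed
  moreover have "card (prod.swap ` T) = card T" by (simp add: card_image)
  moreover have "card (Id :: 'n rel) = CARD('n)"
  proof -
    have "card (range (\<lambda>i :: 'n. (i, i))) = CARD('n)"
      by (intro card_image) (simp add: inj_on_def)
    moreover have "(Id :: 'n rel) = range (\<lambda>i. (i, i))" by auto
    ultimately show ?thesis by simp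
  qed
  ultimately have cardT: "card T = CARD('n) * (CARD('n) - 1) div 2"
    by (simp add: diff_mult_distrib2)
  define Z :: "('a^'n^'n) set" where "Z = {A. \<forall>i j. (i, j) \<notin> T \<longrightarrow> A $ i $ j = 0}"
  have "matsp.subspace Z"
    by (auto simp: matsp.subspace_def Z_def mat_scale_def)
  moreover have "Z \<subseteq> nilpotent_mats"
  proof
    fix A assume A: "A \<in> Z"
    \<comment> \<open>Each factor \<open>A\<close> raises the \<open>h\<close>-value of the index by
      at least 1. As all values are below \<open>CARD('n)\<close>, the power with that exponent
      vanishes.\<close>
    have pow: "(((**) A) ^^ k) (mat 1) $ i $ j = 0" if "h j < h i + k" for k i j
      using that
    proof (induction k arbitrary: i)
      case 0
      then show ?case by (auto simp: mat_def)
    next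
      case (Suc k)
      have zero: "A $ i $ l * (((**) A) ^^ k) (mat 1) $ l $ j = 0" for l
        using Suc A by (cases "h i < h l") (auto simp: Z_def T_def)
      have "(A ** (((**) A) ^^ k) (mat 1)) $ i $ j =
          (\<Sum>l\<in>UNIV. A $ i $ l * (((**) A) ^^ k) (mat 1) $ l $ j)"
        by (simp add: matrix_matrix_mult_def)
      also have "\<dots> = 0" by (intro sum.neutral ballI zero)
      finally show ?case by simp
    qed
    have "(((**) A) ^^ CARD('n)) (mat 1) = 0"
      using pow[OF trans_less_add2[OF bound]] by (simp add: vec_eq_iff)
    then show "A \<in> nilpotent_mats"
      by (auto simp: nilpotent_mats_def nilpotent_mat_def)
  qed
  moreover have "matsp.dim Z = card T"
  proof (rule matsp.dim_unique)
    show "mat_unit ` T \<subseteq> Z" by (auto simp: Z_def mat_unit_def)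
    show "Z \<subseteq> matsp.span (mat_unit ` T)"
      by (auto simp: Z_def intro: mem_span_mat_unit)
    show "card (mat_unit ` T :: ('a^'n^'n) set) = card T"
      by (intro card_image inj_on_subset[OF inj_mat_unit]) auto
  qed (rule independent_mat_unit)
  ultimately show ?thesis using cardT by auto
qed

theorem theorem9:
  shows "(\<forall>(S :: ('a::field^'n^'n) set) d. affine_subspace_of_dim S d \<and> S \<subseteq> nilpotent_mats
            \<longrightarrow> d \<le> CARD('n) * (CARD('n) - 1) div 2)
    \<and> (\<exists>S :: ('a^'n^'n) set. affine_subspace_of_dim S (CARD('n) * (CARD('n) - 1) div 2)
            \<and> S \<subseteq> nilpotent_mats)
    \<and> (CHAR('a) = 0 \<longrightarrow>
        (\<forall>(S :: ('a^'n^'n) set) d.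
            affine_subspace_of_dim S d \<and> S \<subseteq> nilpotent_mats \<and> \<not> matsp.subspace S
            \<longrightarrow> int d \<le> int (CARD('n) * (CARD('n) - 1) div 2) - 1))"
proof (intro conjI allI impI)
  fix S :: "('a^'n^'n) set" and d
  assume "affine_subspace_of_dim S d \<and> S \<subseteq> nilpotent_mats"
  then show "d \<le> CARD('n) * (CARD('n) - 1) div 2"
    using affine_nilpotent_dim_le by (auto simp: affine_subspace_of_dim_def)
next
  obtain Z :: "('a^'n^'n) set" where "matsp.subspace Z" "Z \<subseteq> nilpotent_mats"
    "matsp.dim Z = CARD('n) * (CARD('n) - 1) div 2"
    using exists_nilpotent_subspace by blast
  then show "\<exists>S :: ('a^'n^'n) set. affine_subspace_of_dim S (CARD('n) * (CARD('n) - 1) div 2)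
            \<and> S \<subseteq> nilpotent_mats"
    unfolding affine_subspace_of_dim_def by (intro exI[of _ Z] conjI exI[of _ 0]) auto
next
  fix S :: "('a^'n^'n) set" and d
  assume char: "CHAR('a) = 0"
    and S: "affine_subspace_of_dim S d \<and> S \<subseteq> nilpotent_mats \<and> \<not> matsp.subspace S"
  then obtain P Z where Z: "matsp.subspace Z" "S = (+) P ` Z" "matsp.dim Z = d"
    by (auto simp: affine_subspace_of_dim_def)
  \<comment> \<open>Characteristic zero enters through the infinitude of the field, on which the
    polynomial identity argument rests.\<close>
  have inf: "infinite (UNIV :: 'a set)"
    using finite_imp_CHAR_pos[where 'a = 'a] char by fastforce
  have "P \<notin> Z"
  proof
    assume P: "P \<in> Z"
    have "(+) P ` Z = Z"
    proof
      show "(+) P ` Z \<subseteq> Z" using Z(1) P by (auto intro: matsp.subspace_add)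
      show "Z \<subseteq> (+) P ` Z"
        using Z(1) P by (auto intro!: image_eqI[of _ _ "_ - P"] matsp.subspace_diff)
    qed
    with Z S show False by simp
  qed
  \<comment> \<open>\<open>Suc d\<close> on the left avoids truncated subtraction: for
    \<open>CARD('n) = 1\<close> the right side is 0 and no such \<open>S\<close> exists.\<close>
  then have "Suc d \<le> CARD('n) * (CARD('n) - 1) div 2"
    using affine_nilpotent_dim_less[OF Z(1) _ inf] Z S by blast
  then show "int d \<le> int (CARD('n) * (CARD('n) - 1) div 2) - 1" by linarith
qed

end
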